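(* Let $1<r_1<r_2<\dots<r_l$ be integers and let $\alpha_1,\dots,\alpha_l$ be non-negative constants with $\sum_{i=1}^{l}\frac{\alpha_i}{(r_i-1)!}\le 1$. Let $H$ be a $\{1,r_1,\dots,r_l\}$-graph. If $V(H^1)\neq D(H[V(H^1)])$, then $$L_{\{\alpha_1,\dots,\alpha_l\}}(H)=L_{\{\alpha_1,\dots,\alpha_l\}}\big(H[V(H^1)\setminus D(H[V(H^1)])]\big);$$ and if $V(H^1)=D(H[V(H^1)])$, then $L_{\{\alpha_1,\dots,\alpha_l\}}(H)=1$.
   Context: A hypergraph $H=(V,E)$ with $V=[n]$ has edges that are subsets of $V$; $T(H)=\{|e|:e\in E\}$, and $H$ is a $T(H)$-graph. For $r\in T(H)$, $H^r$ is the hypergraph of all edges of $H$ of size $r$; in particular $V(H^1)$ is the set of vertices $i$ with $\{i\}\in E$. For $W\subseteq V$, $H[W]$ is the induced subhypergraph on $W$ (all edges of $H$ contained in $W$). For a $\{1,r_1,\dots,r_l\}$-graph $H$, a vertex $i\in V(H^1)$ is isolated in $H$ if no edge of $H$ of size $r_1,\dots,r_l$ contains $i$; $D(H)$ denotes the set of isolated vertices of $H$. Let $S=\{\vec x\in\mathbb{R}^n:\sum_i x_i=1,\ x_i\ge 0\}$. For $\vec x\in S$, $$L_{\{\alpha_1,\dots,\alpha_l\}}(H,\vec x)=\sum_{\{i\}\in E}x_i+\sum_{k=1}^{l}\alpha_k\sum_{e\in E,\ |e|=r_k}\prod_{i\in e}x_i,$$ and $L_{\{\alpha_1,\dots,\alpha_l\}}(H)=\max_{\vec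 x\in S}L_{\{\alpha_1,\dots,\alpha_l\}}(H,\vec x)$ (for a hypergraph on a vertex set $W$, the maximum is over the simplex in $\mathbb{R}^W$). *)

theory Defs
  imports "HOL-Analysis.Analysis"
begin

record 'a hypergraph =
  verts :: "'a set"
  edges :: "'a set set"

definition hypergraph :: "'a hypergraph \<Rightarrow> bool" where
  "hypergraph H \<longleftrightarrow> (\<forall>e\<in>edges H. e \<subseteq> verts H)"

definition edge_sizes :: "'a hypergraph \<Rightarrow> nat set" where
  "edge_sizes H = card ` edges H"

(* The vertex set of the r-th level is the set of vertices covered by an edge of
   size r, not the whole of verts H; for r = 1 it is {i. {i} \<in> edges H}. *)
definition level :: "'a hypergraph \<Rightarrow> nat \<Rightarrow> 'a hypergraph" where
  "level H r = (let F = {e \<in> edges H. card e = r} in \<lparr>verts = \<Union>F, edges = F\<rparr>)"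

definition induced :: "'a hypergraph \<Rightarrow> 'a set \<Rightarrow> 'a hypergraph" where
  "induced H W = \<lparr>verts = W, edges = {e \<in> edges H. e \<subseteq> W}\<rparr>"

(* R is the set {r_1, ..., r_l} of non-trivial edge sizes. It is a parameter because an
   induced subhypergraph need not have edges of every one of these sizes. *)
definition isolated :: "nat set \<Rightarrow> 'a hypergraph \<Rightarrow> 'a set" where
  "isolated R H = {i \<in> verts (level H 1). \<not> (\<exists>e\<in>edges H. card e \<in> R \<and> i \<in> e)}"

(* A point of R^W is represented by its extension by zero. *)
definition simplex_on :: "'a set \<Rightarrow> ('a \<Rightarrow> real) set" where
  "simplex_on W = {x. (\<forall>i\<in>W. 0 \<le> x i) \<and> (\<forall>i. i \<notin> W \<longrightarrow> x i = 0) \<and> (\<Sum>i\<in>W. x i) = 1}"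

definition lagr_poly ::
  "nat \<Rightarrow> (nat \<Rightarrow> nat) \<Rightarrow> (nat \<Rightarrow> real) \<Rightarrow> 'a hypergraph \<Rightarrow> ('a \<Rightarrow> real) \<Rightarrow> real" where
  "lagr_poly l r \<alpha> H x =
     (\<Sum>i | {i} \<in> edges H. x i) +
     (\<Sum>k = 1..l. \<alpha> k * (\<Sum>e | e \<in> edges H \<and> card e = r k. \<Prod>i\<in>e. x i))"

(* The maximum of the polynomial over the simplex; it exists by lagrangian_attained below. *)
definition lagrangian ::
  "nat \<Rightarrow> (nat \<Rightarrow> nat) \<Rightarrow> (nat \<Rightarrow> real) \<Rightarrow> 'a hypergraph \<Rightarrow> real" where
  "lagrangian l r \<alpha> H =
     (GREATEST v. v \<in> lagr_poly l r \<alpha> H ` simplex_on (verts H))"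

lemma verts_level_1: "verts (level H 1) = {i. {i} \<in> edges H}"
  by (auto simp: level_def Let_def card_1_singleton_iff)

lemma simplex_on_nonempty:
  assumes "finite W" "W \<noteq> {}"
  shows "simplex_on W \<noteq> {}"
proof -
  obtain w where "w \<in> W" using assms by auto
  then have "(\<lambda>i. if i = w then 1 else 0) \<in> simplex_on W"
    using assms by (auto simp: simplex_on_def)
  then show ?thesis by blast
qed

lemma compact_simplex_on:
  assumes "finite W"
  shows "compact (simplex_on W)"
proof -
  let ?B = "\<lambda>i. if i \<in> W then {0..1::real} else {0}"
  have "compactin (product_topology (\<lambda>i. euclidean) UNIV) (PiE UNIV ?B)"
    by (subst compactin_PiE) auto
  then have cB: "compact (PiE UNIV ?B)"
    by (simp add: euclidean_product_topology)
  have cl: "closed {x :: 'a \<Rightarrow> real. (\<Sum>i\<in>W. x i) = 1}"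
    by (intro closed_Collect_eq continuous_intros continuous_on_product_coordinates)
  have le1: "x i \<le> 1" if "x \<in> simplex_on W" "i \<in> W" for x i
    using that assms member_le_sum[of i W x] by (auto simp: simplex_on_def)
  have "simplex_on W = PiE UNIV ?B \<inter> {x. (\<Sum>i\<in>W. x i) = 1}"
    using le1 by (auto simp: simplex_on_def PiE_iff split: if_splits)
  then show ?thesis using compact_Int_closed[OF cB cl] by simp
qed

lemma lagrangian_attained:
  assumes "finite (verts H)" "verts H \<noteq> {}"
  obtains x where "x \<in> simplex_on (verts H)" "lagrangian l r \<alpha> H = lagr_poly l r \<alpha> H x"
    "\<And>y. y \<in> simplex_on (verts H) \<Longrightarrow> lagr_poly l r \<alpha> H y \<le> lagrangian l r \<alpha> H"
proof -
  have "continuous_on (simplex_on (verts H)) (lagr_poly l r \<alpha> H)"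
    unfolding lagr_poly_def
    by (intro continuous_intros continuous_on_subset[OF continuous_on_product_coordinates]) auto
  then obtain x where x: "x \<in> simplex_on (verts H)"
      "\<forall>y\<in>simplex_on (verts H). lagr_poly l r \<alpha> H y \<le> lagr_poly l r \<alpha> H x"
    using continuous_attains_sup[OF compact_simplex_on simplex_on_nonempty] assms by blast
  have "lagrangian l r \<alpha> H = lagr_poly l r \<alpha> H x"
    unfolding lagrangian_def by (rule Greatest_equality) (use x in auto)
  with x that show ?thesis by auto
qed

end

theory Submission
  imports Defs
begin

text \<open>
  Write \<open>V1\<close> for the set of vertices \<open>i\<close> with \<open>{i}\<close> an edge, and let \<open>x\<close> be a point of the simplex
  with mass \<open>a\<close> outside \<open>V1\<close>. Every non-trivial edge \<open>e\<close> leaving \<open>V1\<close> splits off a vertex outside \<open>V1\<close>,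
  and the elementary symmetric polynomial of degree \<open>r - 1\<close> is at most \<open>1 / (r - 1)!\<close> on the simplex,
  so by the bound on the weights these edges contribute at most \<open>a\<close>. The singletons contribute
  \<open>1 - a\<close>. Hence the polynomial is at most \<open>1\<close> plus the contribution of the edges inside \<open>V1\<close>. These
  edges avoid the isolated vertices, and their contribution only increases when all the mass lost
  by restricting \<open>x\<close> to the non-isolated vertices is added to one of them.
\<close>

text \<open>Induction on \<open>A\<close>: subsets of \<open>insert v A\<close> split according to
  whether they contain \<open>v\<close>, and the two induction bounds together are the first two
  terms of the binomial expansion of the new power.\<close>

lemma sum_prod_subsets_le:
  fixes x :: "'a \<Rightarrow> real"
  assumes "finite A" "\<And>i. i \<in> A \<Longrightarrow> 0 \<le> x i"
  shows "(\<Sum>f | f \<subseteq> A \<and> card f = k. \<Prod>i\<in>f. x i) \<le> (\<Sum>i\<in>A. x i) ^ k / fact k"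
  using assms
proof (induction A arbitrary: k rule: finite_induct)
  case empty
  have "{f :: 'a set. f \<subseteq> {} \<and> card f = k} = (if k = 0 then {{}} else {})"
    by auto
  then show ?case by simp
next
  case (insert v A)
  let ?K = "\<lambda>B k. {f. f \<subseteq> B \<and> card f = k}"
  let ?S = "\<Sum>i\<in>A. x i"
  have S: "0 \<le> ?S" and v: "0 \<le> x v" using insert.prems by (auto intro: sum_nonneg)
  show ?case
  proof (cases k)
    case 0
    \<comment> \<open>Infinite sets also have \<open>card\<close> 0; finiteness of \<open>A\<close>
      excludes them.\<close>
    have "?K (insert v A) 0 = {{}}"
      using insert.hyps by (auto dest: finite_subset)
    then show ?thesis using 0 by simp
  next
    case (Suc m)
    have split: "?K (insert v A) (Suc m) = ?K A (Suc m) \<union> insert v ` ?K A m"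
    proof (intro equalityI subsetI)
      fix f assume f: "f \<in> ?K (insert v A) (Suc m)"
      show "f \<in> ?K A (Suc m) \<union> insert v ` ?K A m"
      proof (cases "v \<in> f")
        case True
        with f have "f = insert v (f - {v})" "f - {v} \<in> ?K A m"
          by auto
        then show ?thesis by blast
      qed (use f in auto)
    qed (use insert.hyps finite_subset[OF _ insert.hyps(1)] in \<open>auto simp: card_insert_if subset_iff\<close>)
    have inj: "inj_on (insert v) (?K A m)"
      using insert.hyps by (auto simp: inj_on_def)
    have "(\<Sum>f\<in>?K (insert v A) (Suc m). prod x f)
        = (\<Sum>f\<in>?K A (Suc m). prod x f) + (\<Sum>f\<in>insert v ` ?K A m. prod x f)"
      unfolding split using insert.hyps by (intro sum.union_disjoint) auto
    also have "(\<Sum>f\<in>insert v ` ?K A m. prod x f) = (\<Sum>f\<in>?K A m. x v * prod x f)"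
      unfolding sum.reindex[OF inj] o_def
    proof (rule sum.cong)
      fix f assume "f \<in> ?K A m"
      then have "finite f" "v \<notin> f" using insert.hyps finite_subset by auto
      then show "prod x (insert v f) = x v * prod x f" by simp
    qed simp
    also have "\<dots> = x v * (\<Sum>f\<in>?K A m. prod x f)"
      by (simp add: sum_distrib_left)
    also have "(\<Sum>f\<in>?K A (Suc m). prod x f) + x v * (\<Sum>f\<in>?K A m. prod x f)
        \<le> ?S ^ Suc m / fact (Suc m) + x v * (?S ^ m / fact m)"
      using insert.prems v by (intro add_mono mult_left_mono insert.IH) auto
    also have "\<dots> = (?S ^ Suc m + real (Suc m) * x v * ?S ^ m) / fact (Suc m)"
      by (simp add: divide_simps del: of_nat_Suc)
    also have "\<dots> \<le> (x v + ?S) ^ Suc m / fact (Suc m)"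
    proof (rule divide_right_mono)
      \<comment> \<open>The terms \<open>j = 0\<close> and \<open>j = 1\<close> are exactly the
        numerator above; the remaining binomial terms are nonnegative.\<close>
      have "(\<Sum>j\<in>{0,1}. real (Suc m choose j) * x v ^ j * ?S ^ (Suc m - j))
          \<le> (\<Sum>j\<le>Suc m. real (Suc m choose j) * x v ^ j * ?S ^ (Suc m - j))"
        using S v by (intro sum_mono2) auto
      also have "\<dots> = (x v + ?S) ^ Suc m"
        by (rule binomial_ring[symmetric])
      finally show "?S ^ Suc m + real (Suc m) * x v * ?S ^ m \<le> (x v + ?S) ^ Suc m"
        by simp
    qed simp
    finally show ?thesis using Suc insert.hyps by simp
  qed
qed

text \<open>Charge each edge \<open>e\<close> to a pair \<open>(i, e - {i})\<close> with
  \<open>i\<close> in \<open>e\<close> and in \<open>A\<close>. Since \<open>insert i f\<close>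
  recovers the edge, no pair is charged twice, and pairs charged by no edge (such as those with
  \<open>i\<close> in \<open>f\<close>) only add nonnegative terms. The sum over all pairs factors,
  and its second factor is an elementary symmetric polynomial at total mass 1.\<close>

lemma sum_prod_meeting_le:
  fixes x :: "'a \<Rightarrow> real"
  assumes "finite V" "\<And>i. i \<in> V \<Longrightarrow> 0 \<le> x i" "(\<Sum>i\<in>V. x i) = 1" "A \<subseteq> V" "0 < m"
    and E: "\<And>e. e \<in> E \<Longrightarrow> e \<subseteq> V \<and> card e = m \<and> e \<inter> A \<noteq> {}"
  shows "(\<Sum>e\<in>E. \<Prod>i\<in>e. x i) \<le> (\<Sum>i\<in>A. x i) / fact (m - 1)"
proof -
  let ?K = "{f. f \<subseteq> V \<and> card f = m - 1}"
  have fA: "finite A" using assms finite_subset by blast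
  have "finite E"
    by (rule finite_subset[of _ "Pow V"]) (use E assms(1) in blast)+
  moreover have "finite (A \<times> ?K)" using fA assms by simp
  moreover have "\<forall>p\<in>A \<times> ?K. 0 \<le> (case p of (i, f) \<Rightarrow> x i * prod x f)"
    using assms(2,4) by (auto intro!: mult_nonneg_nonneg prod_nonneg)
  moreover have "\<forall>e\<in>E. \<exists>p\<in>A \<times> ?K. (case p of (i, f) \<Rightarrow> insert i f) = e \<and>
      prod x e \<le> (case p of (i, f) \<Rightarrow> x i * prod x f)"
  proof
    fix e assume "e \<in> E"
    with E obtain i where i: "i \<in> e" "i \<in> A" "e \<subseteq> V" "card e = m" by blast
    then have "finite e" using assms finite_subset by blast
    then have "(i, e - {i}) \<in> A \<times> ?K" "insert i (e - {i}) = e" "prod x e = x i * prod x (e - {i})"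
      using i by (auto simp: prod.remove)
    then show "\<exists>p\<in>A \<times> ?K. (case p of (i, f) \<Rightarrow> insert i f) = e \<and>
        prod x e \<le> (case p of (i, f) \<Rightarrow> x i * prod x f)"
      by (intro bexI[of _ "(i, e - {i})"]) auto
  qed
  ultimately have "(\<Sum>e\<in>E. prod x e) \<le> (\<Sum>(i, f)\<in>A \<times> ?K. x i * prod x f)"
    by (rule sum_le_included)
  also have "\<dots> = (\<Sum>i\<in>A. x i) * (\<Sum>f\<in>?K. prod x f)"
    by (simp add: sum_product sum.cartesian_product)
  also have "\<dots> \<le> (\<Sum>i\<in>A. x i) * ((\<Sum>i\<in>V. x i) ^ (m - 1) / fact (m - 1))"
    using assms by (intro mult_left_mono sum_prod_subsets_le sum_nonneg) auto
  finally show ?thesis using assms by simp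
qed

text \<open>With \<open>a\<close> the mass outside \<open>U\<close>, the linear part is
  \<open>1 - a\<close>, while the edges leaving \<open>U\<close> contribute at most \<open>a\<close>
  times the sum in \<open>bound\<close>. They gain no more than the linear part lost.\<close>

lemma lagr_poly_le:
  assumes H: "hypergraph H" and fin: "finite (verts H)"
    and r: "\<forall>k\<in>{1..l}. 1 < r k" and \<alpha>: "\<forall>k\<in>{1..l}. 0 \<le> \<alpha> k"
    and bound: "(\<Sum>k = 1..l. \<alpha> k / fact (r k - 1)) \<le> 1"
    and x: "x \<in> simplex_on (verts H)"
  defines "U \<equiv> {i. {i} \<in> edges H}"
  shows "lagr_poly l r \<alpha> H x
    \<le> 1 + (\<Sum>k = 1..l. \<alpha> k * (\<Sum>e | e \<in> edges H \<and> e \<subseteq> U \<and> card e = r k. \<Prod>i\<in>e. x i))"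
proof -
  define a where "a = (\<Sum>i\<in>verts H - U. x i)"
  have x0: "0 \<le> x i" for i using x by (cases "i \<in> verts H") (auto simp: simplex_on_def)
  have x1: "(\<Sum>i\<in>verts H. x i) = 1" using x by (simp add: simplex_on_def)
  have U: "U \<subseteq> verts H" using H by (auto simp: hypergraph_def U_def)
  have finE: "finite (edges H)"
    by (rule finite_subset[of _ "Pow (verts H)"]) (use H fin in \<open>auto simp: hypergraph_def\<close>)
  have a: "(\<Sum>i\<in>U. x i) + a = 1" "0 \<le> a"
    using sum.subset_diff[OF U fin, of x] x1 x0 by (auto simp: a_def sum_nonneg)
  let ?in = "\<lambda>k. {e. e \<in> edges H \<and> e \<subseteq> U \<and> card e = r k}"
  let ?out = "\<lambda>k. {e. e \<in> edges H \<and> \<not> e \<subseteq> U \<and> card e = r k}"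
  have "(\<Sum>k = 1..l. \<alpha> k * (\<Sum>e | e \<in> edges H \<and> card e = r k. prod x e))
      \<le> (\<Sum>k = 1..l. \<alpha> k * (\<Sum>e\<in>?in k. prod x e) + a * (\<alpha> k / fact (r k - 1)))"
  proof (rule sum_mono)
    fix k assume k: "k \<in> {1..l}"
    have eq: "{e. e \<in> edges H \<and> card e = r k} = ?in k \<union> ?out k" by blast
    have "(\<Sum>e | e \<in> edges H \<and> card e = r k. prod x e)
        = (\<Sum>e\<in>?in k. prod x e) + (\<Sum>e\<in>?out k. prod x e)"
      unfolding eq by (rule sum.union_disjoint) (use finE in auto)
    also have "(\<Sum>e\<in>?out k. prod x e) \<le> a / fact (r k - 1)"
      unfolding a_def
    proof (rule sum_prod_meeting_le[OF fin x0 x1])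
      show "0 < r k" using r k by force
      show "e \<subseteq> verts H \<and> card e = r k \<and> e \<inter> (verts H - U) \<noteq> {}" if "e \<in> ?out k" for e
        using that H unfolding hypergraph_def by blast
    qed auto
    finally have "\<alpha> k * (\<Sum>e | e \<in> edges H \<and> card e = r k. prod x e)
        \<le> \<alpha> k * ((\<Sum>e\<in>?in k. prod x e) + a / fact (r k - 1))"
      using \<alpha> k by (simp add: mult_left_mono)
    then show "\<alpha> k * (\<Sum>e | e \<in> edges H \<and> card e = r k. prod x e)
        \<le> \<alpha> k * (\<Sum>e\<in>?in k. prod x e) + a * (\<alpha> k / fact (r k - 1))"
      by (simp add: algebra_simps)
  qed
  also have "\<dots> = (\<Sum>k = 1..l. \<alpha> k * (\<Sum>e\<in>?in k. prod x e)) + a * (\<Sum>k = 1..l. \<alpha> k / fact (r k - 1))"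
    by (simp add: sum.distrib sum_distrib_left)
  also have "\<dots> \<le> (\<Sum>k = 1..l. \<alpha> k * (\<Sum>e\<in>?in k. prod x e)) + a"
    using mult_left_mono[OF bound a(2)] by simp
  finally show ?thesis using a(1) by (simp add: lagr_poly_def U_def)
qed

lemma lagr_poly_mono:
  assumes "finite (edges H)" "edges G \<subseteq> edges H" "finite {i. {i} \<in> edges H}"
    and "\<forall>k\<in>{1..l}. 0 \<le> \<alpha> k" "\<And>i. 0 \<le> x i"
  shows "lagr_poly l r \<alpha> G x \<le> lagr_poly l r \<alpha> H x"
  unfolding lagr_poly_def using assms
  by (intro add_mono sum_mono mult_left_mono sum_mono2) (auto intro: prod_nonneg)

lemma simplex_on_mono:
  assumes "finite V" "W \<subseteq> V"
  shows "simplex_on W \<subseteq> simplex_on V"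
proof
  fix x assume x: "x \<in> simplex_on W"
  have "(\<Sum>i\<in>V. x i) = (\<Sum>i\<in>W. x i)"
    using assms x by (intro sum.mono_neutral_right) (auto simp: simplex_on_def)
  moreover have "0 \<le> x i" for i
    using x by (cases "i \<in> W") (auto simp: simplex_on_def)
  ultimately show "x \<in> simplex_on V"
    using x assms by (auto simp: simplex_on_def)
qed

text \<open>The mass of \<open>x\<close> lying outside \<open>W\<close> is moved to a single vertex
  \<open>w\<close> of \<open>W\<close>, so no coordinate in \<open>W\<close> decreases.\<close>

lemma simplex_on_dominates:
  assumes "finite V" "W \<subseteq> V" "W \<noteq> {}" "x \<in> simplex_on V"
  obtains y where "y \<in> simplex_on W" "\<And>i. i \<in> W \<Longrightarrow> x i \<le> y i"
proof -
  obtain w where w: "w \<in> W" using assms by blast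
  have fW: "finite W" using assms finite_subset by blast
  have x0: "0 \<le> x i" for i using assms by (cases "i \<in> V") (auto simp: simplex_on_def)
  have "(\<Sum>i\<in>W. x i) \<le> (\<Sum>i\<in>V. x i)"
    using assms x0 by (intro sum_mono2) auto
  then have a: "(\<Sum>i\<in>W. x i) \<le> 1" using assms by (simp add: simplex_on_def)
  define y where "y i = (if i \<in> W then x i + (if i = w then 1 - (\<Sum>i\<in>W. x i) else 0) else 0)" for i
  have "(\<Sum>i\<in>W. y i) = 1"
    using fW w by (simp add: y_def sum.distrib)
  then have "y \<in> simplex_on W"
    using x0 a by (auto simp: simplex_on_def y_def)
  moreover have "x i \<le> y i" if "i \<in> W" for i using that a by (simp add: y_def)
  ultimately show ?thesis by (rule that)
qed

theorem theorem9:
  fixes n l :: nat and r :: "nat \<Rightarrow> nat" and \<alpha> :: "nat \<Rightarrow> real"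
    and H :: "nat hypergraph"
  assumes "1 \<le> l"
    and "\<forall>k\<in>{1..l}. 1 < r k"
    and "strict_mono_on {1..l} r"
    and "\<forall>k\<in>{1..l}. 0 \<le> \<alpha> k"
    and "(\<Sum>k = 1..l. \<alpha> k / fact (r k - 1)) \<le> 1"
    and "hypergraph H" and "verts H = {1..n}"
    and "edge_sizes H = insert 1 (r ` {1..l})"
  defines "V1 \<equiv> verts (level H 1)"
  defines "D \<equiv> isolated (r ` {1..l}) (induced H V1)"
  shows "(V1 \<noteq> D \<longrightarrow> lagrangian l r \<alpha> H = lagrangian l r \<alpha> (induced H (V1 - D)))
       \<and> (V1 = D \<longrightarrow> lagrangian l r \<alpha> H = 1)"
proof -
  define W where "W = V1 - D"
  let ?L = "lagrangian l r \<alpha>" and ?P = "lagr_poly l r \<alpha>"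
  have fin: "finite (verts H)" using assms(7) by simp
  have V1: "V1 = {i. {i} \<in> edges H}" unfolding V1_def by (rule verts_level_1)
  have V1_sub: "V1 \<subseteq> verts H" using assms(6) by (auto simp: V1 hypergraph_def)
  have fV1: "finite V1" using V1_sub fin finite_subset by blast
  have finE: "finite (edges H)"
    by (rule finite_subset[of _ "Pow (verts H)"]) (use assms(6) fin in \<open>auto simp: hypergraph_def\<close>)
  have D_sub: "D \<subseteq> V1"
    unfolding D_def isolated_def verts_level_1 by (auto simp: induced_def)
  \<comment> \<open>An edge of size 1 guarantees a simplex over \<open>V1\<close>, and also that
    \<open>verts H\<close> is nonempty, so that the maximum exists.\<close>
  have "1 \<in> edge_sizes H" using assms(8) by simp
  then have V1_ne: "V1 \<noteq> {}"
    by (auto simp: edge_sizes_def V1 card_1_singleton_iff dest!: sym[of "Suc 0"])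
  \<comment> \<open>Such an edge survives in \<open>induced H V1\<close>, so none of its vertices is
    isolated there.\<close>
  have edge_W: "e \<subseteq> W" if "e \<in> edges H" "e \<subseteq> V1" "card e = r k" "k \<in> {1..l}" for e k
    using that unfolding W_def D_def isolated_def verts_level_1 by (auto simp: induced_def)
  have upper: "?P H x \<le> 1 + (\<Sum>k = 1..l. \<alpha> k * (\<Sum>e | e \<in> edges H \<and> e \<subseteq> W \<and> card e = r k. \<Prod>i\<in>e. x i))"
    (is "_ \<le> 1 + ?Q x") if "x \<in> simplex_on (verts H)" for x
  proof -
    have "{e. e \<in> edges H \<and> e \<subseteq> V1 \<and> card e = r k} = {e. e \<in> edges H \<and> e \<subseteq> W \<and> card e = r k}"
      if "k \<in> {1..l}" for k
      using edge_W that W_def by blast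
    then show ?thesis
      using lagr_poly_le[OF assms(6) fin assms(2,4,5) that] by (simp add: V1)
  qed
  \<comment> \<open>Every vertex of \<open>W\<close> is a singleton edge, so the linear part is the
    total mass 1. Hence the bound in \<open>upper\<close> is the polynomial of
    \<open>induced H W\<close> itself, once the point lies in the simplex over
    \<open>W\<close>.\<close>
  have P_ind: "?P (induced H W) y = 1 + ?Q y" if "y \<in> simplex_on W" for y
  proof -
    have "{i. {i} \<in> edges (induced H W)} = W"
      by (auto simp: induced_def W_def V1)
    then show ?thesis
      using that by (simp add: lagr_poly_def simplex_on_def induced_def conj_assoc)
  qed
  obtain x where x: "x \<in> simplex_on (verts H)" "?L H = ?P H x"
    and x_max: "\<And>y. y \<in> simplex_on (verts H) \<Longrightarrow> ?P H y \<le> ?L H"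
    using lagrangian_attained[of H] fin V1_ne V1_sub by (metis subset_empty)
  have first: "?L H = ?L (induced H W)" if "V1 \<noteq> D"
  proof (rule antisym)
    have W: "W \<noteq> {}" "W \<subseteq> verts H" "finite W"
      using that D_sub V1_sub fV1 by (auto simp: W_def)
    obtain z where z: "z \<in> simplex_on W" "?L (induced H W) = ?P (induced H W) z"
      and z_max: "\<And>y. y \<in> simplex_on W \<Longrightarrow> ?P (induced H W) y \<le> ?L (induced H W)"
      using lagrangian_attained[of "induced H W" l r \<alpha>] W
      by (metis hypergraph.select_convs(1) induced_def)
    obtain y where y: "y \<in> simplex_on W" "\<And>i. i \<in> W \<Longrightarrow> x i \<le> y i"
      using simplex_on_dominates[OF fin W(2,1) x(1)] by blast
    have x0: "0 \<le> x i" if "i \<in> W" for i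
      using x(1) W(2) that by (auto simp: simplex_on_def)
    have "?L H \<le> 1 + ?Q x" using upper[OF x(1)] x(2) by simp
    \<comment> \<open>\<open>?Q\<close> involves only coordinates in \<open>W\<close> and is
      monotone in them, as weights and coordinates are nonnegative.\<close>
    also have "\<dots> \<le> 1 + ?Q y"
      using assms(4) x0 y(2)
      by (intro add_left_mono sum_mono mult_left_mono prod_mono) auto
    also have "\<dots> \<le> ?L (induced H W)"
      using z_max[OF y(1)] P_ind[OF y(1)] by simp
    finally show "?L H \<le> ?L (induced H W)" .
    have "0 \<le> z i" for i using z(1) by (cases "i \<in> W") (auto simp: simplex_on_def)
    then have "?P (induced H W) z \<le> ?P H z"
      using finE fV1 assms(4) by (intro lagr_poly_mono) (auto simp: induced_def V1)
    also have "\<dots> \<le> ?L H"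
      using simplex_on_mono[OF fin W(2)] z(1) x_max by blast
    finally show "?L (induced H W) \<le> ?L H" using z(2) by simp
  qed
  have second: "?L H = 1" if "V1 = D"
  proof (rule antisym)
    have "W = {}" using that by (simp add: W_def)
    \<comment> \<open>Only the empty edge could lie inside \<open>W\<close>, but its size 0 is
      excluded by \<open>1 < r k\<close>.\<close>
    then have empty: "{e. e \<in> edges H \<and> e \<subseteq> W \<and> card e = r k} = {}" if "k \<in> {1..l}" for k
      using assms(2) that by force
    have "?Q x = 0" by (rule sum.neutral) (simp add: empty del: Collect_empty_eq)
    then show "?L H \<le> 1" using upper[OF x(1)] x(2) by simp
    obtain z where z: "z \<in> simplex_on V1" using simplex_on_nonempty[OF fV1 V1_ne] by blast
    have z0: "0 \<le> z i" for i using z by (cases "i \<in> V1") (auto simp: simplex_on_def)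
    \<comment> \<open>All mass of \<open>z\<close> sits on \<open>V1\<close>, so the linear part
      alone is already 1.\<close>
    have "1 \<le> ?P H z"
      using z z0 assms(4)
      by (auto simp: lagr_poly_def V1[symmetric] simplex_on_def
          intro!: sum_nonneg mult_nonneg_nonneg prod_nonneg)
    also have "\<dots> \<le> ?L H"
      using simplex_on_mono[OF fin V1_sub] z x_max by blast
    finally show "1 \<le> ?L H" .
  qed
  show ?thesis using first second by (simp add: W_def)
qed

end
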